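(* Let $n\ge1$, let $\lambda=(\lambda_1\ge\cdots\ge\lambda_n\ge0)$ be a partition with at most $n$ nonzero parts, let $T\in\mathrm{GT}(\lambda)$ and let $\mathrm{rsort}^{-1}(T)=\{F\in\mathrm{CSF}(\lambda):\mathrm{rsort}(F)=T\}$. Then: (1) $\displaystyle\sum_{F\in\mathrm{rsort}^{-1}(T)}q^{\mathrm{inv}(F)}=\sum_{F\in\mathrm{rsort}^{-1}(T)}q^{\mathrm{quinv}(F)}=\mathrm{wt}_q(T)$. (2) $\mathrm{inv}(F)+\mathrm{quinv}(F)=\mathrm{area}(T)$ for every $F\in\mathrm{rsort}^{-1}(T)$; in particular this sum is constant on $\mathrm{rsort}^{-1}(T)$.
   Context: $[n]=\{1,\dots,n\}$. The Young diagram $\mathrm{dg}(\lambda)$ is drawn in English convention (row $i$ from the top has $\lambda_i$ cells, left-justified). $\mathrm{CSF}(\lambda)$ is the set of column strict fillings: maps $F:\mathrm{dg}(\lambda)\to[n]$ whose values strictly increase going down each column (no condition on rows). $\mathrm{rsort}(F)$ sorts the entries of each row of $F$ in ascending order; for $F\in\mathrm{CSF}(\lambda)$ it is a semistandard Young tableau. $\mathrm{GT}(\lambda)$ is the set of integral Gelfand-Tsetlin patterns with bounding row $\lambda$: integer arrays $T=(T^j_i)_{1\le i\le j\le n}$ with $T^n_i=\lambda_i$ and $T^{j+1}_i\ge T^j_i\ge T^{j+1}_{i+1}$. $T$ is identified with the semistandard Young tableau of shape $\lambda$ with entries in $[n]$ for which $(T^j_1,\dots,T^j_j)$ is the shape formed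 by the cells with entries $\le j$. Put $\mathrm{NE}_{ij}(T)=T^{j+1}_i-T^j_i$, $\mathrm{SE}_{ij}(T)=T^j_i-T^{j+1}_{i+1}$, $$\mathrm{wt}_q(T)=\prod_{1\le i\le j<n}\binom{\mathrm{NE}_{ij}(T)+\mathrm{SE}_{ij}(T)}{\mathrm{NE}_{ij}(T)}_q,\qquad \mathrm{area}(T)=\sum_{1\le i\le j<n}\mathrm{NE}_{ij}(T)\,\mathrm{SE}_{ij}(T),$$ where $\binom{a}{b}_q$ is the $q$-binomial (Gaussian) coefficient. Statistics. Let $F\in\mathrm{CSF}(\lambda)$. $\mathrm{quinv}(F)$ is the number of triples of cells $(x,y,z)$ with $x,z\in\mathrm{dg}(\lambda)$ in the same row, $z$ to the right of $x$, $y$ the position immediately below $x$ in its column, and $F(x)<F(z)<F(y)$, where $F(y)=\infty$ if $y\notin\mathrm{dg}(\lambda)$. $\mathrm{inv}(F)$ is the Haglund-Haiman-Loehr statistic, in English convention: two cells attack each other if they are in the same row, or are in rows $i$ and $i+1$ with the cell in row $i+1$ in a column strictly to the right of that of the cell in row $i$. The reading order goes through the rows from the lowest row to the top row, left to right in each row. $\mathrm{Inv}(F)$ is the set of pairs of attacking cells $\{u,w\}$ with $u$ preceding $w$ in reading order and $F(u)>F(w)$. $\mathrm{Des}(F)$ is the set of cells $u$ not in the top row with $F(u)$ greater than the entry of the cell immediately above $u$. $\mathrm{arm}(u)$ is the number of cells strictly to the right of $u$ in its row. Then $\mathrm{inv}(F)=|\mathrm{Inv}(F)|-\sum_{u\in\mathrm{Des}(F)}\mathrm{arm}(u)$.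 *)

theory Defs
  imports
    "HOL-Library.FuncSet"
    "HOL-Library.Extended_Nat"
    "HOL-Computational_Algebra.Polynomial"
    "HOL-Computational_Algebra.Fraction_Field"
begin

text \<open>
  All indices start at 1. A partition with at most \<open>n\<close> nonzero parts is a function
  \<open>lam :: nat \<Rightarrow> nat\<close> of which only the values at \<open>1, \<dots>, n\<close> are relevant. A cell is a pair
  \<open>(row, column)\<close>; rows are numbered from top to bottom.
\<close>

type_synonym cell = "nat \<times> nat"

definition partition_at_most :: "nat \<Rightarrow> (nat \<Rightarrow> nat) \<Rightarrow> bool" where
  "partition_at_most n lam \<longleftrightarrow> (\<forall>i\<in>{1..<n}. lam (i + 1) \<le> lam i)"

definition dg :: "nat \<Rightarrow> (nat \<Rightarrow> nat) \<Rightarrow> cell set" where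
  "dg n lam = {(i, c). 1 \<le> i \<and> i \<le> n \<and> 1 \<le> c \<and> c \<le> lam i}"

definition CSF :: "nat \<Rightarrow> (nat \<Rightarrow> nat) \<Rightarrow> (cell \<Rightarrow> nat) set" where
  "CSF n lam = {F \<in> dg n lam \<rightarrow>\<^sub>E {1..n}.
     \<forall>i c. (i, c) \<in> dg n lam \<longrightarrow> (i + 1, c) \<in> dg n lam \<longrightarrow> F (i, c) < F (i + 1, c)}"

definition SSYT :: "nat \<Rightarrow> (nat \<Rightarrow> nat) \<Rightarrow> (cell \<Rightarrow> nat) set" where
  "SSYT n lam = {S \<in> CSF n lam.
     \<forall>i c. (i, c) \<in> dg n lam \<longrightarrow> (i, c + 1) \<in> dg n lam \<longrightarrow> S (i, c) \<le> S (i, c + 1)}"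

definition rsort :: "nat \<Rightarrow> (nat \<Rightarrow> nat) \<Rightarrow> (cell \<Rightarrow> nat) \<Rightarrow> (cell \<Rightarrow> nat)" where
  "rsort n lam F =
     restrict (\<lambda>(i, c). sort (map (\<lambda>d. F (i, d)) [1..<lam i + 1]) ! (c - 1)) (dg n lam)"

text \<open>
  A Gelfand-Tsetlin pattern is a function \<open>T\<close>, where \<open>T j i\<close> stands for $T^j_i$; values outside
  the triangle \<open>1 \<le> i \<le> j \<le> n\<close> are irrelevant. Since the bounding row is nonnegative,
  interlacing makes every entry of an integral pattern nonnegative, so nothing is lost by taking
  entries in \<open>nat\<close>; the interlacing also ensures that the subtractions in \<open>NE\<close> and \<open>SE\<close> do not
  truncate.
\<close>

definition GT :: "nat \<Rightarrow> (nat \<Rightarrow> nat) \<Rightarrow> (nat \<Rightarrow> nat \<Rightarrow> nat) set" where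
  "GT n lam = {T.
     (\<forall>i\<in>{1..n}. T n i = lam i) \<and>
     (\<forall>j\<in>{1..<n}. \<forall>i\<in>{1..j}. T (j + 1) i \<ge> T j i \<and> T j i \<ge> T (j + 1) (i + 1))}"

text \<open>The identification of patterns with tableaux: row \<open>j\<close> of the pattern \<open>T\<close> is the shape formed
  by the cells of the tableau \<open>S\<close> with entries at most \<open>j\<close>.\<close>

definition pattern_tableau ::
  "nat \<Rightarrow> (nat \<Rightarrow> nat) \<Rightarrow> (nat \<Rightarrow> nat \<Rightarrow> nat) \<Rightarrow> (cell \<Rightarrow> nat) \<Rightarrow> bool" where
  "pattern_tableau n lam T S \<longleftrightarrow> S \<in> SSYT n lam \<and>
     (\<forall>j\<in>{1..n}. {x \<in> dg n lam. S x \<le> j} = dg j (T j))"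

definition rsort_fiber ::
  "nat \<Rightarrow> (nat \<Rightarrow> nat) \<Rightarrow> (nat \<Rightarrow> nat \<Rightarrow> nat) \<Rightarrow> (cell \<Rightarrow> nat) set" where
  "rsort_fiber n lam T = {F \<in> CSF n lam. pattern_tableau n lam T (rsort n lam F)}"

definition NE :: "(nat \<Rightarrow> nat \<Rightarrow> nat) \<Rightarrow> nat \<Rightarrow> nat \<Rightarrow> nat" where
  "NE T i j = T (j + 1) i - T j i"

definition SE :: "(nat \<Rightarrow> nat \<Rightarrow> nat) \<Rightarrow> nat \<Rightarrow> nat \<Rightarrow> nat" where
  "SE T i j = T j i - T (j + 1) (i + 1)"

definition q_int :: "'a::field \<Rightarrow> nat \<Rightarrow> 'a" where
  "q_int q m = (\<Sum>k<m. q ^ k)"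

definition q_fact :: "'a::field \<Rightarrow> nat \<Rightarrow> 'a" where
  "q_fact q m = (\<Prod>k=1..m. q_int q k)"

text \<open>Only meaningful for \<open>b \<le> a\<close> and for \<open>q\<close> with all \<open>q_int q m\<close> (\<open>m \<ge> 1\<close>) nonzero, in particular
  for an indeterminate \<open>q\<close>.\<close>

definition q_binomial :: "'a::field \<Rightarrow> nat \<Rightarrow> nat \<Rightarrow> 'a" where
  "q_binomial q a b = q_fact q a / (q_fact q b * q_fact q (a - b))"

definition wt :: "'a::field \<Rightarrow> nat \<Rightarrow> (nat \<Rightarrow> nat \<Rightarrow> nat) \<Rightarrow> 'a" where
  "wt q n T = (\<Prod>j\<in>{1..<n}. \<Prod>i\<in>{1..j}. q_binomial q (NE T i j + SE T i j) (NE T i j))"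

definition area :: "nat \<Rightarrow> (nat \<Rightarrow> nat \<Rightarrow> nat) \<Rightarrow> nat" where
  "area n T = (\<Sum>j\<in>{1..<n}. \<Sum>i\<in>{1..j}. NE T i j * SE T i j)"

text \<open>The indeterminate of the field $\mathbf{Q}(q)$ of rational functions. The exponent \<open>hhl_inv\<close>
  below is an integer that is not visibly nonnegative, so the generating functions are
  a priori Laurent polynomials.\<close>

definition indet :: "rat poly fract" where
  "indet = Fract [:0, 1:] 1"

definition entry_or_infinity :: "nat \<Rightarrow> (nat \<Rightarrow> nat) \<Rightarrow> (cell \<Rightarrow> nat) \<Rightarrow> cell \<Rightarrow> enat" where
  "entry_or_infinity n lam F x = (if x \<in> dg n lam then enat (F x) else \<infinity>)"

definition quinv :: "nat \<Rightarrow> (nat \<Rightarrow> nat) \<Rightarrow> (cell \<Rightarrow> nat) \<Rightarrow> nat" where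
  "quinv n lam F = card {(x, y, z).
     x \<in> dg n lam \<and> z \<in> dg n lam \<and> fst x = fst z \<and> snd x < snd z \<and>
     y = (fst x + 1, snd x) \<and>
     F x < F z \<and> enat (F z) < entry_or_infinity n lam F y}"

definition attack :: "cell \<Rightarrow> cell \<Rightarrow> bool" where
  "attack u w \<longleftrightarrow>
     (fst u = fst w \<and> snd u \<noteq> snd w) \<or>
     (fst w = fst u + 1 \<and> snd w > snd u) \<or>
     (fst u = fst w + 1 \<and> snd u > snd w)"

definition reads_before :: "cell \<Rightarrow> cell \<Rightarrow> bool" where
  "reads_before u w \<longleftrightarrow> fst u > fst w \<or> (fst u = fst w \<and> snd u < snd w)"

definition Inv_set :: "nat \<Rightarrow> (nat \<Rightarrow> nat) \<Rightarrow> (cell \<Rightarrow> nat) \<Rightarrow> (cell \<times> cell) set" where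
  "Inv_set n lam F = {(u, w). u \<in> dg n lam \<and> w \<in> dg n lam \<and>
     attack u w \<and> reads_before u w \<and> F u > F w}"

definition Des_set :: "nat \<Rightarrow> (nat \<Rightarrow> nat) \<Rightarrow> (cell \<Rightarrow> nat) \<Rightarrow> cell set" where
  "Des_set n lam F = {u \<in> dg n lam. fst u > 1 \<and> F u > F (fst u - 1, snd u)}"

definition arm :: "nat \<Rightarrow> (nat \<Rightarrow> nat) \<Rightarrow> cell \<Rightarrow> nat" where
  "arm n lam u = card {w \<in> dg n lam. fst w = fst u \<and> snd w > snd u}"

definition hhl_inv :: "nat \<Rightarrow> (nat \<Rightarrow> nat) \<Rightarrow> (cell \<Rightarrow> nat) \<Rightarrow> int" where
  "hhl_inv n lam F = int (card (Inv_set n lam F)) - int (\<Sum>u\<in>Des_set n lam F. arm n lam u)"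

end

theory Submission
  imports Defs
begin

text \<open>
  Let \<open>quinv_by R\<close> count the triples of \<open>quinv\<close> with the condition "\<open>z\<close> is to the right of \<open>x\<close>"
  replaced by a relation \<open>R\<close> between the columns of \<open>x\<close> and \<open>z\<close>. Then \<open>quinv\<close> is \<open>quinv_by (<)\<close>,
  and since every cell below the top row of a column strict filling is a descent, a count of pairs
  in adjacent rows shows that \<open>inv\<close> is \<open>quinv_by (>)\<close>.

  A filling belongs to the fibre of \<open>T\<close> iff row \<open>i\<close> has exactly \<open>T\<^sup>j\<^sub>i\<close> entries \<open>\<le> j\<close>. Removing
  the cells with the largest entry \<open>j + 1\<close> from such a filling amounts to choosing, in each row \<open>i\<close>,
  \<open>NE\<close> of the \<open>NE + SE\<close> cells that end their columns; what remains is an arbitrary filling of the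
  smaller (no longer left-justified) diagram. A triple whose \<open>z\<close> is removed consists of a removed
  and a kept cell among these column ends, so the choice in row \<open>i\<close> contributes the inversion
  generating function of the \<open>NE\<close>-element subsets of an (\<open>NE + SE\<close>)-element set. This is the
  \<open>q\<close>-binomial coefficient for \<open><\<close> as well as for \<open>>\<close>, while the total number of such pairs,
  regardless of the order of the columns, is \<open>NE \<cdot> SE\<close>.
\<close>

section \<open>Inversions of subsets and q-binomial coefficients\<close>

lemma q_int_add: "q_int q (a + b) = q_int q b + q ^ b * q_int q a"
  by (induction a) (auto simp: q_int_def algebra_simps power_add)

lemma q_fact_Suc: "q_fact q (Suc m) = q_int q (Suc m) * q_fact q m"
  by (simp add: q_fact_def mult.commute)

lemma q_fact_nonzero:
  assumes "\<And>m. m \<ge> 1 \<Longrightarrow> q_int q m \<noteq> 0"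
  shows "q_fact q m \<noteq> 0"
  using assms by (auto simp: q_fact_def)

lemma q_binomial_0 [simp]:
  assumes "\<And>m. m \<ge> 1 \<Longrightarrow> q_int q m \<noteq> 0"
  shows "q_binomial q m 0 = 1"
  using q_fact_nonzero[OF assms, of m] by (simp add: q_binomial_def) (simp add: q_fact_def)

lemma q_binomial_self:
  assumes "\<And>m. m \<ge> 1 \<Longrightarrow> q_int q m \<noteq> 0"
  shows "q_binomial q m m = 1"
  using q_fact_nonzero[OF assms, of m] by (simp add: q_binomial_def) (simp add: q_fact_def)

lemma q_binomial_symmetric:
  "b \<le> a \<Longrightarrow> q_binomial q a (a - b) = q_binomial q a b"
  by (simp add: q_binomial_def mult.commute)

text \<open>The q-Pascal rule, obtained by splitting \<open>q_int q (Suc m)\<close> into its low and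
  its high powers of \<open>q\<close>. The bound \<open>a < m\<close> matters: at
  \<open>a = m\<close> truncated subtraction makes \<open>q_binomial q m (Suc m)\<close> nonzero
  instead of 0.\<close>

lemma q_binomial_Suc_Suc:
  assumes nz: "\<And>m. m \<ge> 1 \<Longrightarrow> q_int q m \<noteq> 0" and "a < m"
  shows "q_binomial q (Suc m) (Suc a) = q ^ (m - a) * q_binomial q m a + q_binomial q m (Suc a)"
proof -
  obtain b where m: "m = a + Suc b" using \<open>a < m\<close> by (metis less_natE add_Suc_right)
  have int: "q_int q (Suc m) = q_int q (Suc b) + q ^ Suc b * q_int q (Suc a)"
    using q_int_add[of q "Suc a" "Suc b"] by (simp add: m)
  have [simp]: "q_int q (Suc k) \<noteq> 0" "q_fact q k \<noteq> 0" for k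
    using nz q_fact_nonzero[OF nz] by auto
  have "q_binomial q (Suc m) (Suc a)
      = (q_int q (Suc b) + q ^ Suc b * q_int q (Suc a)) * q_fact q m
        / ((q_int q (Suc a) * q_fact q a) * (q_int q (Suc b) * q_fact q b))"
    unfolding int[symmetric] by (simp add: q_binomial_def q_fact_Suc m)
  also have "\<dots> = q ^ Suc b * (q_fact q m / (q_fact q a * (q_int q (Suc b) * q_fact q b)))
      + q_fact q m / ((q_int q (Suc a) * q_fact q a) * q_fact q b)"
    by (simp add: divide_simps) (simp add: algebra_simps)
  finally show ?thesis by (simp add: q_binomial_def q_fact_Suc m)
qed

definition cross :: "('a \<Rightarrow> 'a \<Rightarrow> bool) \<Rightarrow> 'a set \<Rightarrow> 'a set \<Rightarrow> nat" where
  "cross R A B = card {(c, d). c \<in> A \<and> d \<in> B \<and> R c d}"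

text \<open>Kept as a property of a relation \<open>R\<close>, so that the recursion over fillings
  is carried out once and serves both orders of the columns.\<close>

definition subset_gf :: "(nat \<Rightarrow> nat \<Rightarrow> bool) \<Rightarrow> 'a::field \<Rightarrow> bool" where
  "subset_gf R q \<longleftrightarrow> (\<forall>S a. finite S \<longrightarrow> a \<le> card S \<longrightarrow>
     (\<Sum>A | A \<subseteq> S \<and> card A = a. q ^ cross R (S - A) A) = q_binomial q (card S) a)"

lemma cross_empty [simp]: "cross R {} B = 0" "cross R A {} = 0"
  by (simp_all add: cross_def)

text \<open>Induction on the largest element \<open>m\<close> of the ground set. If \<open>m\<close>
  lies outside \<open>A\<close>, it is smaller than no element of \<open>A\<close>; if it lies in
  \<open>A\<close>, it exceeds every element of the complement. The two cases give the two terms of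
  the q-Pascal rule.\<close>

lemma subset_gf_less:
  assumes nz: "\<And>m. m \<ge> 1 \<Longrightarrow> q_int q m \<noteq> 0"
  shows "subset_gf (<) q"
  unfolding subset_gf_def
proof (intro allI impI)
  fix S :: "nat set" and a
  assume "finite S" "a \<le> card S"
  then show "(\<Sum>A | A \<subseteq> S \<and> card A = a. q ^ cross (<) (S - A) A) = q_binomial q (card S) a"
  proof (induction S arbitrary: a rule: finite_linorder_max_induct)
    case empty
    have "{A. A \<subseteq> ({}::nat set) \<and> card A = a} = {{}}" using empty by auto
    then show ?case using empty nz by simp
  next
    case (insert m S)
    have m: "m \<notin> S" and card: "card (insert m S) = Suc (card S)"
      using insert.hyps by auto
    \<comment> \<open>The two extreme sizes are outside the range of
      \<open>q_binomial_Suc_Suc\<close>; each is attained by a single subset.\<close>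
    consider "a = 0" | "a = Suc (card S)" | b where "a = Suc b" "b < card S"
      using insert.prems card by (cases a) (auto simp: le_less)
    then show ?case
    proof cases
      case 1
      have "{A. A \<subseteq> insert m S \<and> card A = a} = {{}}"
        using insert.hyps 1 by (auto dest: finite_subset)
      then show ?thesis using 1 nz by simp
    next
      case 2
      have "A = insert m S" if "A \<subseteq> insert m S" "card A = a" for A
        using that insert.hyps(1) card 2 by (intro card_subset_eq) auto
      then have "{A. A \<subseteq> insert m S \<and> card A = a} = {insert m S}"
        using card 2 by blast
      then show ?thesis using 2 nz card by (simp add: q_binomial_self)
    next
      case 3
      define U where "U = {A. A \<subseteq> S \<and> card A = Suc b}"
      define V where "V = {A. A \<subseteq> S \<and> card A = b}"
      have fin: "finite U" "finite V" using insert.hyps by (auto simp: U_def V_def)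
      have mem: "A \<in> V \<Longrightarrow> finite A \<and> m \<notin> A" "A \<in> U \<Longrightarrow> m \<notin> A" for A
        using insert.hyps m by (auto simp: V_def U_def dest: finite_subset)
      have split: "{A. A \<subseteq> insert m S \<and> card A = a} = U \<union> insert m ` V"
      proof (intro equalityI subsetI)
        fix A assume A: "A \<in> {A. A \<subseteq> insert m S \<and> card A = a}"
        then have "finite A" using insert.hyps by (auto dest: finite_subset)
        show "A \<in> U \<union> insert m ` V"
        proof (cases "m \<in> A")
          case True
          then have "A = insert m (A - {m})" "A - {m} \<in> V"
            using A \<open>finite A\<close> 3 by (auto simp: V_def)
          then show ?thesis by blast
        qed (use A 3 in \<open>auto simp: U_def\<close>)
      next
        fix A assume "A \<in> U \<union> insert m ` V"
        then consider "A \<in> U" | B where "B \<in> V" "A = insert m B" by blast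
        then show "A \<in> {A. A \<subseteq> insert m S \<and> card A = a}"
        proof cases
          case 2
          then have "card A = a" using mem(1)[of B] 3 by (simp add: V_def)
          then show ?thesis using 2 by (auto simp: V_def)
        qed (use 3 in \<open>auto simp: U_def\<close>)
      qed
      have disj: "U \<inter> insert m ` V = {}" using mem by auto
      have inj: "inj_on (insert m) V"
        using mem(1) unfolding inj_on_def by (metis insert_ident)
      have U: "cross (<) (insert m S - A) A = cross (<) (S - A) A" if "A \<in> U" for A
      proof -
        have "{(c, d). c \<in> insert m S - A \<and> d \<in> A \<and> c < d} = {(c, d). c \<in> S - A \<and> d \<in> A \<and> c < d}"
          using that insert.hyps(2) by (fastforce simp: U_def)
        then show ?thesis by (simp add: cross_def)
      qed
      have V: "cross (<) (insert m S - insert m A) (insert m A) = cross (<) (S - A) A + (card S - b)"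
        if "A \<in> V" for A
      proof -
        have A: "A \<subseteq> S" "card A = b" "finite A" using that mem(1)[OF that] by (simp_all add: V_def)
        define P where "P = {(c, d). c \<in> S - A \<and> d \<in> A \<and> c < d}"
        have "{(c, d). c \<in> insert m S - insert m A \<and> d \<in> insert m A \<and> c < d}
            = P \<union> (S - A) \<times> {m}"
          using m insert.hyps(2) by (auto simp: P_def)
        moreover have "finite P"
          by (rule finite_subset[of _ "S \<times> A"]) (use A insert.hyps in \<open>auto simp: P_def\<close>)
        moreover have "P \<inter> (S - A) \<times> {m} = {}" using A m by (auto simp: P_def)
        moreover have "cross (<) (S - A) A = card P" by (simp add: cross_def P_def)
        ultimately show ?thesis
          unfolding cross_def[of _ "insert m S - _"] using A insert.hyps(1)
          by (simp only: card_Un_disjoint finite_cartesian_product finite_Diff finite.intros)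
            (simp add: card_cartesian_product card_Diff_subset)
      qed
      have "(\<Sum>A | A \<subseteq> insert m S \<and> card A = a. q ^ cross (<) (insert m S - A) A)
          = (\<Sum>A\<in>U. q ^ cross (<) (S - A) A) + q ^ (card S - b) * (\<Sum>A\<in>V. q ^ cross (<) (S - A) A)"
        unfolding split using fin disj U V
        by (simp add: sum.union_disjoint sum.reindex[OF inj] sum_distrib_left power_add mult.commute)
      also have "\<dots> = q_binomial q (card (insert m S)) a"
        using insert.IH[of b] insert.IH[of "Suc b"] 3 card
        by (simp add: U_def V_def q_binomial_Suc_Suc[OF nz])
      finally show ?thesis .
    qed
  qed
qed

text \<open>Passing from \<open>A\<close> to its complement exchanges \<open><\<close> with \<open>>\<close>.\<close>

lemma subset_gf_greater:
  assumes nz: "\<And>m. m \<ge> 1 \<Longrightarrow> q_int q m \<noteq> 0"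
  shows "subset_gf (>) q"
  unfolding subset_gf_def
proof (intro allI impI)
  fix S :: "nat set" and a
  assume S: "finite S" "a \<le> card S"
  have "cross (>) A (S - A) = cross (<) (S - A) A" for A
    unfolding cross_def by (rule bij_betw_same_card[of prod.swap]) (auto simp: bij_betw_def inj_on_def)
  then have "(\<Sum>A | A \<subseteq> S \<and> card A = a. q ^ cross (>) (S - A) A)
      = (\<Sum>A | A \<subseteq> S \<and> card A = card S - a. q ^ cross (<) (S - A) A)"
    using S by (intro sum.reindex_bij_witness[of _ "\<lambda>A. S - A" "\<lambda>A. S - A"])
      (auto simp: card_Diff_subset finite_subset double_diff, metis double_diff order_refl)
  also have "\<dots> = q_binomial q (card S) a"
    using subset_gf_less[OF nz] S by (simp add: subset_gf_def q_binomial_symmetric)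
  finally show "(\<Sum>A | A \<subseteq> S \<and> card A = a. q ^ cross (>) (S - A) A) = q_binomial q (card S) a" .
qed

section \<open>Nonvanishing of the q-integers at the indeterminate\<close>

lemma indet_power: "indet ^ k = Fract ([:0, 1:] ^ k) 1"
  by (induction k) (auto simp: indet_def One_fract_def)

text \<open>Written over the denominator 1, the numerator takes the value \<open>m\<close> at 1, so
  it is not the zero polynomial.\<close>

lemma q_int_indet_nonzero:
  assumes "m \<ge> 1"
  shows "q_int indet m \<noteq> 0"
proof
  have "q_int indet m = Fract (\<Sum>k<m. [:0, 1:] ^ k) 1"
    unfolding q_int_def by (induction m) (auto simp: indet_power Zero_fract_def)
  moreover assume "q_int indet m = 0"
  ultimately have "(\<Sum>k<m. [:0, 1:] ^ k) = (0 :: rat poly)"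
    by (simp add: Zero_fract_def eq_fract)
  then have "poly (\<Sum>k<m. [:0, 1:] ^ k) (1 :: rat) = 0" by simp
  then show False using assms by (simp add: poly_sum poly_power)
qed

section \<open>Fillings of column-closed diagrams\<close>

text \<open>Columns start in row 1 and have no gaps, but rows may have gaps: this property of Young
  diagrams survives the deletion of column ends.\<close>

definition column_closed :: "cell set \<Rightarrow> bool" where
  "column_closed D \<longleftrightarrow> (\<forall>(i, c)\<in>D. 1 \<le> i \<and> (1 < i \<longrightarrow> (i - 1, c) \<in> D))"

definition row :: "cell set \<Rightarrow> nat \<Rightarrow> nat set" where
  "row D i = {c. (i, c) \<in> D}"

definition bottom :: "cell set \<Rightarrow> nat \<Rightarrow> nat set" where
  "bottom D i = row D i - row D (i + 1)"

text \<open>The counts \<open>\<tau> v i\<close> encode the sorted rows, so that the fibre condition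
  also makes sense on diagrams that are not left-justified.\<close>

definition fillings :: "nat \<Rightarrow> (nat \<Rightarrow> nat \<Rightarrow> nat) \<Rightarrow> cell set \<Rightarrow> (cell \<Rightarrow> nat) set" where
  "fillings j \<tau> D = {F \<in> D \<rightarrow>\<^sub>E {1..j}.
     (\<forall>i c. (i, c) \<in> D \<longrightarrow> (i + 1, c) \<in> D \<longrightarrow> F (i, c) < F (i + 1, c)) \<and>
     (\<forall>v\<in>{1..j}. \<forall>i. card {c \<in> row D i. F (i, c) \<le> v} = \<tau> v i)}"

text \<open>The value infinity of a missing cell below \<open>x\<close> becomes the premise of an
  implication.\<close>

definition quinv_by :: "(nat \<Rightarrow> nat \<Rightarrow> bool) \<Rightarrow> cell set \<Rightarrow> (cell \<Rightarrow> nat) \<Rightarrow> nat" where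
  "quinv_by R D F = card {(i, c, d). R c d \<and> (i, c) \<in> D \<and> (i, d) \<in> D \<and>
     F (i, c) < F (i, d) \<and> ((i + 1, c) \<in> D \<longrightarrow> F (i, d) < F (i + 1, c))}"

lemma quinv_by_empty [simp]: "quinv_by R {} F = 0"
  by (simp add: quinv_by_def case_prod_unfold)

text \<open>A pattern padded with zeros, so that the interlacing inequalities also hold at the
  boundary of the triangle.\<close>

definition padded_pattern :: "nat \<Rightarrow> (nat \<Rightarrow> nat \<Rightarrow> nat) \<Rightarrow> bool" where
  "padded_pattern n \<tau> \<longleftrightarrow> (\<forall>j i. j < i \<longrightarrow> \<tau> j i = 0) \<and> (\<forall>j. \<tau> j 0 = 0) \<and>
     (\<forall>j<n. \<forall>i\<ge>1. \<tau> (j + 1) (i + 1) \<le> \<tau> j i \<and> \<tau> j i \<le> \<tau> (j + 1) i)"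

lemma padded_pattern_outside: "padded_pattern n \<tau> \<Longrightarrow> i = 0 \<or> j < i \<Longrightarrow> \<tau> j i = 0"
  by (auto simp: padded_pattern_def)

section \<open>Column ends and the removal of the largest entry\<close>

lemma finite_row [simp]: "finite D \<Longrightarrow> finite (row D i)"
  by (rule finite_subset[of _ "snd ` D"]) (force simp: row_def)+

lemma finite_bottom [simp]: "finite D \<Longrightarrow> finite (bottom D i)"
  by (simp add: bottom_def)

lemma card_bottom:
  assumes "finite D" "column_closed D" "1 \<le> i"
  shows "card (bottom D i) = card (row D i) - card (row D (i + 1))"
proof -
  have "row D (i + 1) \<subseteq> row D i"
    using assms(2,3) by (force simp: row_def column_closed_def)
  then show ?thesis using assms(1) by (simp add: bottom_def card_Diff_subset)
qed

text \<open>No entry exceeds \<open>m\<close>. If \<open>z\<close> carries \<open>m\<close>, no cell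
  can lie below \<open>x\<close>, and every kept column end of the row can serve as
  \<open>x\<close>. If \<open>z\<close> is kept, so is \<open>x\<close>, and deleting a cell
  \<open>y\<close> with entry \<open>m\<close> changes nothing, because the entry of
  \<open>z\<close> is smaller than \<open>m\<close> anyway.\<close>

lemma quinv_by_remove_max:
  assumes "finite D" "column_closed D" "fst ` D \<subseteq> {..m}"
    and F: "F \<in> D \<rightarrow> {..m}"
    and A: "A = {x \<in> D. F x = m}" and G: "\<And>x. x \<in> D - A \<Longrightarrow> G x = F x"
  shows "quinv_by R D F = quinv_by R (D - A) G
           + (\<Sum>i\<in>{1..m}. cross R (bottom D i - row A i) (row A i))"
proof -
  define Q where "Q = {(i, c, d). R c d \<and> (i, c) \<in> D \<and> (i, d) \<in> D \<and>
     F (i, c) < F (i, d) \<and> ((i + 1, c) \<in> D \<longrightarrow> F (i, d) < F (i + 1, c))}"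
  define P where "P = {(i, c, d). R c d \<and> (i, c) \<in> D - A \<and> (i, d) \<in> D - A \<and>
     G (i, c) < G (i, d) \<and> ((i + 1, c) \<in> D - A \<longrightarrow> G (i, d) < G (i + 1, c))}"
  define M where "M = (SIGMA i:{1..m}.
     {(c, d). c \<in> bottom D i - row A i \<and> d \<in> row A i \<and> R c d})"
  have le: "F x \<le> m" if "x \<in> D" for x using F that by auto
  have rows: "1 \<le> i" "i \<le> m" if "(i, c) \<in> D" for i c
    using assms(2,3) that by (auto simp: column_closed_def)
  have "finite (\<Union>i\<in>fst ` D. {i} \<times> row D i \<times> row D i)" using assms(1) by simp
  moreover have "Q \<subseteq> (\<Union>i\<in>fst ` D. {i} \<times> row D i \<times> row D i)"
    by (force simp: Q_def row_def)
  ultimately have "finite Q" by (rule finite_subset[rotated])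
  have notA: "x \<in> D - A \<longleftrightarrow> x \<in> D \<and> F x < m" for x
    using le[of x] by (auto simp: A)
  have "Q = P \<union> M"
  proof (intro equalityI subsetI)
    fix t assume "t \<in> Q"
    then obtain i c d where t: "t = (i, c, d)" and R: "R c d" and D: "(i, c) \<in> D" "(i, d) \<in> D"
      and lt: "F (i, c) < F (i, d)" and below: "(i + 1, c) \<in> D \<Longrightarrow> F (i, d) < F (i + 1, c)"
      by (auto simp: Q_def)
    show "t \<in> P \<union> M"
    proof (cases "F (i, d) = m")
      case True
      then have "(i + 1, c) \<notin> D" using below le[of "(i + 1, c)"] by auto
      then have "t \<in> M" using True R D lt rows[OF D(1)]
        by (auto simp: t M_def bottom_def row_def A)
      then show ?thesis by simp
    next
      case False
      then have "F (i, d) < m" using le[OF D(2)] by simp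
      then have "(i, c) \<in> D - A" "(i, d) \<in> D - A" using D lt by (auto simp: A)
      then have "t \<in> P" using R lt below G unfolding t P_def by simp
      then show ?thesis by simp
    qed
  next
    fix t assume "t \<in> P \<union> M"
    then show "t \<in> Q"
    proof
      assume "t \<in> P"
      then obtain i c d where t: "t = (i, c, d)" and R: "R c d"
        and D: "(i, c) \<in> D - A" "(i, d) \<in> D - A" and lt: "F (i, c) < F (i, d)"
        and below: "(i + 1, c) \<in> D - A \<longrightarrow> F (i, d) < F (i + 1, c)"
        using G by (fastforce simp: P_def)
      have "F (i, d) < F (i + 1, c)" if "(i + 1, c) \<in> D"
        using below D(2) that notA by (cases "(i + 1, c) \<in> A") (auto simp: A)
      then show ?thesis using t R D lt by (auto simp: Q_def)
    next
      assume "t \<in> M"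
      then obtain i c d where "t = (i, c, d)" "R c d" "(i, c) \<in> D" "(i + 1, c) \<notin> D"
        "F (i, c) \<noteq> m" "(i, d) \<in> D" "F (i, d) = m"
        by (auto simp: M_def bottom_def row_def A)
      then show ?thesis using le[of "(i, c)"] by (auto simp: Q_def)
    qed
  qed
  moreover have "P \<inter> M = {}" by (auto simp: P_def M_def row_def)
  ultimately have "card Q = card P + card M"
    using \<open>finite Q\<close> by (simp add: card_Un_disjoint)
  moreover have "card M = (\<Sum>i\<in>{1..m}. cross R (bottom D i - row A i) (row A i))"
    unfolding M_def cross_def
  proof (rule card_SigmaI)
    show "\<forall>i\<in>{1..m}. finite {(c, d). c \<in> bottom D i - row A i \<and> d \<in> row A i \<and> R c d}"
    proof
      fix i
      have "finite (bottom D i \<times> row A i)" using assms(1) by (simp add: A)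
      then show "finite {(c, d). c \<in> bottom D i - row A i \<and> d \<in> row A i \<and> R c d}"
        by (rule rev_finite_subset) auto
    qed
  qed simp
  ultimately show ?thesis by (simp add: quinv_by_def Q_def P_def)
qed

section \<open>Recursion on the largest entry\<close>

lemma fillingsD:
  assumes "F \<in> fillings j \<tau> D"
  shows "F \<in> D \<rightarrow>\<^sub>E {1..j}"
    and "x \<in> D \<Longrightarrow> 1 \<le> F x \<and> F x \<le> j"
    and "(i, c) \<in> D \<Longrightarrow> (i + 1, c) \<in> D \<Longrightarrow> F (i, c) < F (i + 1, c)"
    and "v \<in> {1..j} \<Longrightarrow> card {c \<in> row D i. F (i, c) \<le> v} = \<tau> v i"
  using assms by (auto simp: fillings_def simp del: atLeastAtMost_iff dest: PiE_mem)
    (metis PiE_mem atLeastAtMost_iff)+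

lemma fillingsI:
  assumes "F \<in> D \<rightarrow>\<^sub>E {1..j}"
    and "\<And>i c. (i, c) \<in> D \<Longrightarrow> (i + 1, c) \<in> D \<Longrightarrow> F (i, c) < F (i + 1, c)"
    and "\<And>v i. v \<in> {1..j} \<Longrightarrow> card {c \<in> row D i. F (i, c) \<le> v} = \<tau> v i"
  shows "F \<in> fillings j \<tau> D"
  using assms by (simp add: fillings_def)

text \<open>By strictness the largest entry can only end a column, and its multiplicity in a row is
  the difference of two consecutive counts.\<close>

lemma fillings_remove_max:
  assumes "finite D" "padded_pattern n \<tau>"
    and rows: "\<And>i. card (row D i) = \<tau> (j + 1) i"
    and F: "F \<in> fillings (j + 1) \<tau> D"
    and A: "A = {x \<in> D. F x = j + 1}"
  shows "row A i \<subseteq> bottom D i" and "card (row A i) = \<tau> (j + 1) i - \<tau> j i"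
    and "restrict F (D - A) \<in> fillings j \<tau> (D - A)"
proof -
  note FD = fillingsD(2)[OF F] and strict = fillingsD(3)[OF F] and cnt = fillingsD(4)[OF F]
  have notA: "x \<in> D - A \<longleftrightarrow> x \<in> D \<and> F x \<le> j" for x
    using FD[of x] by (auto simp: A)
  show "row A i \<subseteq> bottom D i" for i
    using strict FD by (fastforce simp: row_def bottom_def A)
  have "card {c \<in> row D i. F (i, c) \<le> j} = \<tau> j i" for i
  \<comment> \<open>The counts in \<open>fillings\<close> start at \<open>v = 1\<close>, so for
    \<open>j = 0\<close> the value comes from the zero padding instead.\<close>
  proof (cases "j = 0")
    case True
    then have "{c \<in> row D i. F (i, c) \<le> j} = {}" using FD by (fastforce simp: row_def)
    moreover have "\<tau> j i = 0" using True assms(2) by (cases i) (auto simp: padded_pattern_def)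
    ultimately show ?thesis by (simp only: card.empty)
  qed (use cnt in auto)
  moreover have "row A i = row D i - {c \<in> row D i. F (i, c) \<le> j}" for i
    using FD by (fastforce simp: row_def A)
  ultimately show "card (row A i) = \<tau> (j + 1) i - \<tau> j i" for i
    using assms(1) rows by (simp add: card_Diff_subset)
  show "restrict F (D - A) \<in> fillings j \<tau> (D - A)"
  proof (rule fillingsI)
    show "restrict F (D - A) \<in> (D - A) \<rightarrow>\<^sub>E {1..j}"
      unfolding restrict_PiE_iff using FD notA by (metis atLeastAtMost_iff)
    show "restrict F (D - A) (i, c) < restrict F (D - A) (i + 1, c)"
      if "(i, c) \<in> D - A" "(i + 1, c) \<in> D - A" for i c
      using that strict by simp
    show "card {c \<in> row (D - A) i. restrict F (D - A) (i, c) \<le> v} = \<tau> v i" if "v \<in> {1..j}" for v i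
    proof -
      have "{c \<in> row (D - A) i. restrict F (D - A) (i, c) \<le> v} = {c \<in> row D i. F (i, c) \<le> v}"
        using that by (auto simp: row_def A)
      then show ?thesis using cnt that by simp
    qed
  qed
qed

text \<open>The inverse of \<open>fillings_remove_max\<close>: putting \<open>j + 1\<close> on
  column ends keeps columns strict because all other entries are at most \<open>j\<close>. The only
  new count, at \<open>v = j + 1\<close>, is the full row length, which \<open>rows\<close>
  supplies.\<close>

lemma fillings_add_max:
  assumes rows: "\<And>i. card (row D i) = \<tau> (j + 1) i"
    and A: "A \<subseteq> D" "\<And>i. row A i \<subseteq> bottom D i"
    and G: "G \<in> fillings j \<tau> (D - A)"
  defines "F \<equiv> (\<lambda>x. if x \<in> A then j + 1 else G x)"
  shows "F \<in> fillings (j + 1) \<tau> D" "{x \<in> D. F x = j + 1} = A" "restrict F (D - A) = G"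
proof -
  have GD: "1 \<le> G x \<and> G x \<le> j" if "x \<in> D" "x \<notin> A" for x
    using fillingsD(2)[OF G] that by simp
  have Gu: "G x = undefined" if "x \<notin> D" for x
    using PiE_arb[OF fillingsD(1)[OF G]] that by simp
  have FD: "F \<in> D \<rightarrow>\<^sub>E {1..j + 1}"
  proof (rule PiE_I)
    show "F x \<in> {1..j + 1}" if "x \<in> D" for x
      using GD[OF that] by (cases "x \<in> A") (simp_all add: F_def)
    show "F x = undefined" if "x \<notin> D" for x using Gu[OF that] A(1) that by (auto simp: F_def)
  qed
  have "F x = j + 1 \<longleftrightarrow> x \<in> A" if "x \<in> D" for x
    using GD[OF that] by (auto simp: F_def)
  then show "{x \<in> D. F x = j + 1} = A" using A(1) by blast
  show "restrict F (D - A) = G"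
    using PiE_arb[OF fillingsD(1)[OF G]] by (auto simp: F_def fun_eq_iff)
  have strict: "F (i, c) < F (i + 1, c)" if "(i, c) \<in> D" "(i + 1, c) \<in> D" for i c
  proof -
    have "(i, c) \<notin> A" using A(2)[of i] that by (auto simp: row_def bottom_def)
    then show ?thesis
      using fillingsD(3)[OF G] GD[OF that(1)] that by (cases "(i + 1, c) \<in> A") (simp_all add: F_def)
  qed
  have cnt: "card {c \<in> row D i. F (i, c) \<le> v} = \<tau> v i" if "v \<in> {1..j + 1}" for v i
  proof (cases "v = j + 1")
    case True
    then have "{c \<in> row D i. F (i, c) \<le> v} = row D i"
      using PiE_mem[OF FD] by (auto simp: row_def)
    then show ?thesis using rows True by simp
  next
    case False
    then have "{c \<in> row D i. F (i, c) \<le> v} = {c \<in> row (D - A) i. G (i, c) \<le> v}"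
      using that by (auto simp: row_def F_def split: if_splits)
    then show ?thesis using fillingsD(4)[OF G] False that by simp
  qed
  show "F \<in> fillings (j + 1) \<tau> D" using FD strict cnt by (rule fillingsI)
qed

lemma finite_fillings: "finite D \<Longrightarrow> finite (fillings j \<tau> D)"
  by (rule finite_subset[of _ "D \<rightarrow>\<^sub>E {1..j}"]) (auto simp: fillings_def intro!: finite_PiE)

text \<open>Removing column ends in the numbers dictated by the pattern leaves a diagram of the same
  kind, to which an induction hypothesis applies.\<close>

lemma remove_bottoms:
  assumes "finite D" "column_closed D" "padded_pattern n \<tau>" "j < n"
    and rows: "\<And>i. card (row D i) = \<tau> (j + 1) i"
    and A: "A \<subseteq> D" "\<And>i. row A i \<subseteq> bottom D i" "\<And>i. 1 \<le> i \<Longrightarrow> card (row A i) = \<tau> (j + 1) i - \<tau> j i"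
  shows "finite (D - A)" "column_closed (D - A)" "card (row (D - A) i) = \<tau> j i"
proof -
  show "finite (D - A)" using assms(1) by simp
  show "column_closed (D - A)"
    using assms(2) A(2) by (fastforce simp: column_closed_def row_def bottom_def)
  show "card (row (D - A) i) = \<tau> j i"
  proof (cases "i = 0")
    case True
    have "row (D - A) 0 = {}" using assms(2) by (auto simp: row_def column_closed_def)
    then show ?thesis using True assms(3) by (simp add: padded_pattern_def)
  next
    case False
    have "row (D - A) i = row D i - row A i" "row A i \<subseteq> row D i"
      using A(1) by (auto simp: row_def)
    moreover have "\<tau> j i \<le> \<tau> (j + 1) i"
      using assms(3,4) False by (simp add: padded_pattern_def)
    ultimately show ?thesis
      using rows A(3) False assms(1) by (simp add: card_Diff_subset finite_subset)
  qed
qed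

lemma rows_subset_of_card_rows:
  assumes "column_closed D" "padded_pattern n \<tau>" "\<And>i. card (row D i) = \<tau> (j + 1) i" "finite D"
  shows "fst ` D \<subseteq> {1..j + 1}"
proof
  fix i assume "i \<in> fst ` D"
  then obtain c where c: "(i, c) \<in> D" by auto
  then have "row D i \<noteq> {}" by (auto simp: row_def)
  then have "\<tau> (j + 1) i \<noteq> 0" using assms(3)[of i, symmetric] finite_row[OF assms(4)] by simp
  then have "i \<le> j + 1" using padded_pattern_outside[OF assms(2), of i "j + 1"] by linarith
  then show "i \<in> {1..j + 1}" using c assms(1) by (auto simp: column_closed_def)
qed

text \<open>The column ends number \<open>\<tau> (j + 1) i - \<tau> (j + 1) (i + 1)\<close>, and
  interlacing allows this difference to be split at \<open>\<tau> j i\<close> without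
  truncation.\<close>

lemma card_bottom_pattern:
  assumes "finite D" "column_closed D" "padded_pattern n \<tau>" "j < n" "1 \<le> i"
    and rows: "\<And>i. card (row D i) = \<tau> (j + 1) i"
  shows "card (bottom D i) = NE \<tau> i j + SE \<tau> i j"
proof -
  have "\<tau> (j + 1) (i + 1) \<le> \<tau> j i" "\<tau> j i \<le> \<tau> (j + 1) i"
    using assms(3-5) by (simp_all add: padded_pattern_def)
  then show ?thesis
    unfolding card_bottom[OF assms(1,2,5)] rows NE_def SE_def by simp
qed

lemma quinv_by_fillings_Suc:
  assumes D: "finite D" "column_closed D" "padded_pattern n \<tau>"
    and rows: "\<And>i. card (row D i) = \<tau> (j + 1) i"
    and F: "F \<in> fillings (j + 1) \<tau> D" and A: "A = {x \<in> D. F x = j + 1}"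
  shows "quinv_by R D F = quinv_by R (D - A) (restrict F (D - A))
           + (\<Sum>i\<in>{1..j + 1}. cross R (bottom D i - row A i) (row A i))"
proof (rule quinv_by_remove_max[OF D(1,2) _ _ A])
  show "fst ` D \<subseteq> {..j + 1}" using rows_subset_of_card_rows[OF D(2,3) rows D(1)] by auto
  show "F \<in> D \<rightarrow> {..j + 1}" using fillingsD(2)[OF F] by auto
qed simp

text \<open>A choice records the columns of the removed cells row by row;
  \<open>Sigma {1..j + 1} a\<close> turns it back into a set of cells.\<close>

definition choices :: "(nat \<Rightarrow> nat \<Rightarrow> nat) \<Rightarrow> nat \<Rightarrow> cell set \<Rightarrow> (nat \<Rightarrow> nat set) set" where
  "choices \<tau> j D = (\<Pi>\<^sub>E i\<in>{1..j + 1}. {A. A \<subseteq> bottom D i \<and> card A = NE \<tau> i j})"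

text \<open>A filling corresponds to the pair of its set of largest entries and its restriction to
  the other cells; \<open>quinv_by_remove_max\<close> splits the exponent along this
  bijection.\<close>

lemma sum_fillings_Suc:
  fixes q :: "'a::field"
  assumes D: "finite D" "column_closed D" "padded_pattern n \<tau>" "j < n"
    and rows: "\<And>i. card (row D i) = \<tau> (j + 1) i"
  shows "(\<Sum>F\<in>fillings (j + 1) \<tau> D. q ^ quinv_by R D F) =
    (\<Sum>a\<in>choices \<tau> j D. (\<Prod>i\<in>{1..j + 1}. q ^ cross R (bottom D i - a i) (a i)) *
      (\<Sum>G\<in>fillings j \<tau> (D - Sigma {1..j + 1} a). q ^ quinv_by R (D - Sigma {1..j + 1} a) G))"
proof -
  define top where "top F = {x \<in> D. F x = j + 1}" for F :: "cell \<Rightarrow> nat"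
  define ch where "ch F = (\<lambda>i\<in>{1..j + 1}. row (top F) i)" for F
  define ext where "ext a G = (\<lambda>x. if x \<in> Sigma {1..j + 1} a then j + 1 else G x)"
    for a and G :: "cell \<Rightarrow> nat"
  have D_rows: "fst ` D \<subseteq> {1..j + 1}" by (rule rows_subset_of_card_rows[OF D(2,3) rows D(1)])
  have "i \<in> {1..j + 1}" if "(i, c) \<in> D" for i c
    using imageI[OF that, of fst] D_rows by auto
  then have Sigma_ch: "Sigma {1..j + 1} (ch F) = top F" for F
    unfolding ch_def top_def row_def by auto
  have row_Sigma: "row (Sigma {1..j + 1} a) i = (if i \<in> {1..j + 1} then a i else {})" for a i
    by (auto simp: row_def)
  have a: "Sigma {1..j + 1} a \<subseteq> D" "row (Sigma {1..j + 1} a) i \<subseteq> bottom D i"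
    if "a \<in> choices \<tau> j D" for a i
  proof -
    have *: "a i \<subseteq> bottom D i" if "i \<in> {1..j + 1}" for i
      using \<open>a \<in> choices \<tau> j D\<close> that by (auto simp: choices_def PiE_iff)
    then show "Sigma {1..j + 1} a \<subseteq> D" unfolding bottom_def row_def by blast
    show "row (Sigma {1..j + 1} a) i \<subseteq> bottom D i" using * unfolding row_Sigma by simp
  qed
  have ext: "ext a G \<in> fillings (j + 1) \<tau> D" "top (ext a G) = Sigma {1..j + 1} a"
      "restrict (ext a G) (D - Sigma {1..j + 1} a) = G"
    if "a \<in> choices \<tau> j D" "G \<in> fillings j \<tau> (D - Sigma {1..j + 1} a)" for a G
    using fillings_add_max[OF rows a[OF that(1)] that(2)] unfolding ext_def top_def by auto
  have ch_choices: "ch F \<in> choices \<tau> j D" if "F \<in> fillings (j + 1) \<tau> D" for F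
    using fillings_remove_max[OF D(1,3) rows that top_def]
    by (auto simp: choices_def ch_def NE_def)
  have "(\<Sum>F\<in>fillings (j + 1) \<tau> D. q ^ quinv_by R D F) =
     (\<Sum>(a, G)\<in>Sigma (choices \<tau> j D) (\<lambda>a. fillings j \<tau> (D - Sigma {1..j + 1} a)).
       (\<Prod>i\<in>{1..j + 1}. q ^ cross R (bottom D i - a i) (a i))
         * q ^ quinv_by R (D - Sigma {1..j + 1} a) G)"
  proof (rule sum.reindex_bij_witness[of _ "\<lambda>(a, G). ext a G" "\<lambda>F. (ch F, restrict F (D - top F))"])
    fix F assume F: "F \<in> fillings (j + 1) \<tau> D"
    show "(case (ch F, restrict F (D - top F)) of (a, G) \<Rightarrow> ext a G) = F"
    proof
      fix x
      show "(case (ch F, restrict F (D - top F)) of (a, G) \<Rightarrow> ext a G) x = F x"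
        using PiE_arb[OF fillingsD(1)[OF F], of x]
        unfolding prod.case ext_def Sigma_ch by (auto simp: top_def)
    qed
    show "(ch F, restrict F (D - top F))
        \<in> Sigma (choices \<tau> j D) (\<lambda>a. fillings j \<tau> (D - Sigma {1..j + 1} a))"
      using ch_choices[OF F] fillings_remove_max(3)[OF D(1,3) rows F top_def]
      unfolding mem_Sigma_iff Sigma_ch by blast
    have "(\<Prod>i\<in>{1..j + 1}. q ^ cross R (bottom D i - ch F i) (ch F i))
        = q ^ (\<Sum>i\<in>{1..j + 1}. cross R (bottom D i - row (top F) i) (row (top F) i))"
      unfolding power_sum by (intro prod.cong) (auto simp: ch_def)
    then show "(case (ch F, restrict F (D - top F)) of (a, G) \<Rightarrow>
        (\<Prod>i\<in>{1..j + 1}. q ^ cross R (bottom D i - a i) (a i))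
         * q ^ quinv_by R (D - Sigma {1..j + 1} a) G) = q ^ quinv_by R D F"
      unfolding prod.case Sigma_ch quinv_by_fillings_Suc[OF D(1-3) rows F top_def]
      by (simp add: power_add mult.commute)
  next
    fix p assume "p \<in> Sigma (choices \<tau> j D) (\<lambda>a. fillings j \<tau> (D - Sigma {1..j + 1} a))"
    then obtain a G where p: "p = (a, G)" and *: "a \<in> choices \<tau> j D"
      "G \<in> fillings j \<tau> (D - Sigma {1..j + 1} a)" by auto
    show "(case p of (a, G) \<Rightarrow> ext a G) \<in> fillings (j + 1) \<tau> D" using ext[OF *] p by simp
    \<comment> \<open>Outside \<open>{1..j + 1}\<close> both sides are \<open>undefined\<close>, one
      by \<open>restrict\<close>, the other because choices are extensional.\<close>
    have "ch (ext a G) = a"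
      using *(1)[unfolded choices_def, THEN PiE_arb]
      unfolding ch_def ext(2)[OF *] row_Sigma restrict_def by (intro HOL.ext) metis
    then show "(ch (case p of (a, G) \<Rightarrow> ext a G),
        restrict (case p of (a, G) \<Rightarrow> ext a G) (D - top (case p of (a, G) \<Rightarrow> ext a G))) = p"
      unfolding p prod.case ext(2,3)[OF *] by simp
  qed
  also have "\<dots> = (\<Sum>a\<in>choices \<tau> j D. (\<Prod>i\<in>{1..j + 1}. q ^ cross R (bottom D i - a i) (a i)) *
      (\<Sum>G\<in>fillings j \<tau> (D - Sigma {1..j + 1} a). q ^ quinv_by R (D - Sigma {1..j + 1} a) G))"
  proof -
    have "finite (choices \<tau> j D)"
      unfolding choices_def using D(1) by (intro finite_PiE) auto
    then show ?thesis
      using D(1) by (subst sum.Sigma[symmetric]) (auto simp: finite_fillings sum_distrib_left)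
  qed
  finally show ?thesis .
qed

text \<open>The induction is over all diagrams \<open>D\<close> with the given row lengths: the
  inner sum then depends only on the pattern, not on which cells were removed, and factors out.
  Choices in different rows are independent, so the remaining sum is a product over rows, each
  factor being given by \<open>subset_gf\<close>.\<close>

lemma sum_quinv_by_fillings:
  fixes q :: "'a::field"
  assumes "subset_gf R q" "padded_pattern n \<tau>" "j \<le> n" "finite D" "column_closed D"
    "\<And>i. card (row D i) = \<tau> j i"
  shows "(\<Sum>F\<in>fillings j \<tau> D. q ^ quinv_by R D F)
    = (\<Prod>v<j. \<Prod>i\<in>{1..v + 1}. q_binomial q (NE \<tau> i v + SE \<tau> i v) (NE \<tau> i v))"
  using assms(3-)
proof (induction j arbitrary: D)
  case 0
  have "row D i = {}" for i
    using 0(4)[of i] finite_row[OF 0(2), of i] padded_pattern_outside[OF assms(2), of i 0]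
    by (cases "i = 0") simp_all
  then have "D = {}" by (auto simp: row_def)
  moreover have "fillings 0 \<tau> {} = {\<lambda>x. undefined}" by (auto simp: fillings_def)
  ultimately show ?case by simp
next
  case (Suc j)
  have D: "finite D" "column_closed D" "j < n" and rows: "\<And>i. card (row D i) = \<tau> (j + 1) i"
    using Suc.prems by auto
  let ?gf = "\<lambda>j. \<Prod>v<j. \<Prod>i\<in>{1..v + 1}. q_binomial q (NE \<tau> i v + SE \<tau> i v) (NE \<tau> i v)"
  have IH: "(\<Sum>G\<in>fillings j \<tau> (D - Sigma {1..j + 1} a). q ^ quinv_by R (D - Sigma {1..j + 1} a) G)
      = ?gf j" if a: "a \<in> choices \<tau> j D" for a
  proof -
    define A where "A = Sigma {1..j + 1} a"
    have row: "row A i = (if i \<in> {1..j + 1} then a i else {})" for i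
      by (auto simp: row_def A_def)
    have *: "a i \<subseteq> bottom D i \<and> card (a i) = NE \<tau> i j" if "i \<in> {1..j + 1}" for i
      using a that by (auto simp: choices_def PiE_iff)
    have "A \<subseteq> D" using * unfolding A_def bottom_def row_def by blast
    moreover have "row A i \<subseteq> bottom D i" for i using *[of i] by (simp add: row)
    moreover have "card (row A i) = \<tau> (j + 1) i - \<tau> j i" if "1 \<le> i" for i
      using *[of i] padded_pattern_outside[OF assms(2), of i "j + 1"] that
      by (cases "i \<le> j + 1") (simp_all add: row NE_def)
    ultimately show ?thesis
      using remove_bottoms[OF D(1,2) assms(2) D(3) rows] Suc.IH[of "D - A"] D(3)
      by (simp add: A_def)
  qed
  have "(\<Sum>F\<in>fillings (Suc j) \<tau> D. q ^ quinv_by R D F)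
      = (\<Sum>a\<in>choices \<tau> j D. \<Prod>i\<in>{1..j + 1}. q ^ cross R (bottom D i - a i) (a i)) * ?gf j"
    using sum_fillings_Suc[OF D(1,2) assms(2) D(3) rows, of q R] IH
    by (simp add: sum_distrib_right)
  also have "(\<Sum>a\<in>choices \<tau> j D. \<Prod>i\<in>{1..j + 1}. q ^ cross R (bottom D i - a i) (a i))
      = (\<Prod>i\<in>{1..j + 1}. \<Sum>A | A \<subseteq> bottom D i \<and> card A = NE \<tau> i j. q ^ cross R (bottom D i - A) A)"
    unfolding choices_def using D(1) by (intro prod_sum_PiE[symmetric]) auto
  also have "\<dots> = (\<Prod>i\<in>{1..j + 1}. q_binomial q (NE \<tau> i j + SE \<tau> i j) (NE \<tau> i j))"
  proof (rule prod.cong)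
    fix i assume "i \<in> {1..j + 1}"
    then have "card (bottom D i) = NE \<tau> i j + SE \<tau> i j"
      using card_bottom_pattern[OF D(1,2) assms(2) D(3) _ rows] by simp
    then show "(\<Sum>A | A \<subseteq> bottom D i \<and> card A = NE \<tau> i j. q ^ cross R (bottom D i - A) A)
        = q_binomial q (NE \<tau> i j + SE \<tau> i j) (NE \<tau> i j)"
      using assms(1) D(1) by (simp add: subset_gf_def)
  qed simp
  finally show ?case by (simp add: mult.commute)
qed

text \<open>The recursion of \<open>sum_quinv_by_fillings\<close> without a sum: for the relation
  that always holds, a row contributes the product of the numbers of removed and kept column ends,
  whichever cells are removed.\<close>

lemma quinv_by_True:
  assumes "padded_pattern n \<tau>" "j \<le> n" "finite D" "column_closed D"
    "\<And>i. card (row D i) = \<tau> j i" "F \<in> fillings j \<tau> D"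
  shows "quinv_by (\<lambda>_ _. True) D F = (\<Sum>v<j. \<Sum>i\<in>{1..v + 1}. NE \<tau> i v * SE \<tau> i v)"
  using assms(2-)
proof (induction j arbitrary: D F)
  case 0
  have "row D i = {}" for i
    using 0(4)[of i] finite_row[OF 0(2), of i] padded_pattern_outside[OF assms(1), of i 0]
    by (cases "i = 0") simp_all
  then have "D = {}" by (auto simp: row_def)
  then show ?case by simp
next
  case (Suc j)
  have D: "finite D" "column_closed D" "j < n" and rows: "\<And>i. card (row D i) = \<tau> (j + 1) i"
    and F: "F \<in> fillings (j + 1) \<tau> D"
    using Suc.prems by auto
  define A where "A = {x \<in> D. F x = j + 1}"
  note A = fillings_remove_max[OF D(1) assms(1) rows F A_def]
  have "A \<subseteq> D" by (auto simp: A_def)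
  note rem = remove_bottoms[OF D(1,2) assms(1) D(3) rows this A(1,2)]
  have "cross (\<lambda>_ _. True) (bottom D i - row A i) (row A i) = NE \<tau> i j * SE \<tau> i j"
    if "i \<in> {1..j + 1}" for i
  proof -
    have "card (bottom D i - row A i) = SE \<tau> i j"
      using card_bottom_pattern[OF D(1,2) assms(1) D(3) _ rows, of i] that A(1,2)[of i] D(1)
      by (simp add: card_Diff_subset finite_subset NE_def)
    moreover have "cross (\<lambda>_ _. True) U V = card U * card V" for U V :: "nat set"
    proof -
      have "{(c, d). c \<in> U \<and> d \<in> V \<and> True} = U \<times> V" by auto
      then show ?thesis by (simp only: cross_def card_cartesian_product)
    qed
    ultimately show ?thesis using A(2)[of i] by (simp add: NE_def)
  qed
  then show ?case
    using quinv_by_fillings_Suc[OF D(1,2) assms(1) rows F A_def, of "\<lambda>_ _. True"]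
      Suc.IH[OF _ rem A(3)] D(3) by simp
qed

section \<open>The statistics and the sorting map on Young diagrams\<close>

lemma finite_dg: "finite (dg n lam)"
  by (rule finite_subset[of _ "Sigma {1..n} (\<lambda>i. {1..lam i})"]) (auto simp: dg_def)

lemma row_dg: "row (dg n lam) i = (if 1 \<le> i \<and> i \<le> n then {1..lam i} else {})"
  by (auto simp: row_def dg_def)

lemma column_closed_dg:
  assumes "partition_at_most n lam"
  shows "column_closed (dg n lam)"
proof -
  have "lam i \<le> lam (i - 1)" if "1 < i" "i \<le> n" for i
    using assms that unfolding partition_at_most_def by (force dest!: bspec[of _ _ "i - 1"])
  then show ?thesis by (fastforce simp: column_closed_def dg_def)
qed

lemma quinv_eq_quinv_by: "quinv n lam F = quinv_by (<) (dg n lam) F"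
  unfolding quinv_def quinv_by_def
  by (rule bij_betw_same_card[where f = "\<lambda>(x, y, z). (fst x, snd x, snd z)"],
      rule bij_betw_byWitness[where f' = "\<lambda>(i, c, d). ((i, c), (i + 1, c), (i, d))"])
    (auto simp: entry_or_infinity_def split: if_splits)

text \<open>The columns of a counted triple differ because the entries of \<open>x\<close> and
  \<open>z\<close> do.\<close>

lemma quinv_by_less_add_greater:
  assumes "finite D"
  shows "quinv_by (<) D F + quinv_by (>) D F = quinv_by (\<lambda>_ _. True) D F"
proof -
  define Q where "Q R = {(i, c, d). R c d \<and> (i, c) \<in> D \<and> (i, d) \<in> D \<and>
     F (i, c) < F (i, d) \<and> ((i + 1, c) \<in> D \<longrightarrow> F (i, d) < F (i + 1, c))}" for R
  have "finite (\<Union>i\<in>fst ` D. {i} \<times> row D i \<times> row D i)" using assms by simp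
  moreover have "Q R \<subseteq> (\<Union>i\<in>fst ` D. {i} \<times> row D i \<times> row D i)" for R
    by (force simp: Q_def row_def)
  ultimately have fin: "finite (Q R)" for R by (blast intro: finite_subset)
  have "Q (\<lambda>_ _. True) = Q (<) \<union> Q (>)" by (auto simp: Q_def) (metis less_irrefl nat_neq_iff)+
  moreover have "Q (<) \<inter> Q (>) = {}" by (auto simp: Q_def)
  moreover have "quinv_by R D F = card (Q R)" for R by (simp add: quinv_by_def Q_def)
  ultimately show ?thesis using fin by (simp add: card_Un_disjoint)
qed

text \<open>
  Below \<open>U\<close> indexes the pairs counted by the arms (all cells below the top row are descents),
  \<open>P\<close> and \<open>V\<close> the inversions inside a row and between adjacent rows. Every triple of \<open>U\<close> that
  is not an inversion between rows forces an inversion in the upper row, and the inversions of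
  \<open>P\<close> that are not forced in this way are the triples counted by \<open>quinv_by (>)\<close>.
\<close>

lemma hhl_inv_eq_quinv_by:
  assumes "partition_at_most n lam" "F \<in> CSF n lam"
  shows "hhl_inv n lam F = int (quinv_by (>) (dg n lam) F)"
proof -
  define D where "D = dg n lam"
  define P where "P = {(i, c, d). c < d \<and> (i, c) \<in> D \<and> (i, d) \<in> D \<and> F (i, d) < F (i, c)}"
  define U where "U = {(i, c, d). c < d \<and> (i, c) \<in> D \<and> (i + 1, d) \<in> D}"
  define V where "V = {(i, c, d). c < d \<and> (i, c) \<in> D \<and> (i + 1, d) \<in> D \<and> F (i, c) < F (i + 1, d)}"
  have fin: "finite D" by (simp add: D_def finite_dg)
  have closed: "1 \<le> i" "1 < i \<Longrightarrow> (i - 1, c) \<in> D" if "(i, c) \<in> D" for i c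
    using column_closed_dg[OF assms(1)] that by (auto simp: D_def column_closed_def)
  have left: "(i, c) \<in> D" if "(i, d) \<in> D" "1 \<le> c" "c < d" for i c d
    using that by (auto simp: D_def dg_def)
  have pos: "1 \<le> c" if "(i, c) \<in> D" for i c using that by (simp add: D_def dg_def)
  have strict: "F (i, c) < F (i + 1, c)" if "(i, c) \<in> D" "(i + 1, c) \<in> D" for i c
    using assms(2) that by (simp add: CSF_def D_def)
  have "P \<union> U \<subseteq> fst ` D \<times> snd ` D \<times> snd ` D" by (force simp: P_def U_def)
  then have "finite (P \<union> U)" by (rule finite_subset) (use fin in simp)
  then have finPU: "finite P" "finite U" by auto
  have VU: "V \<subseteq> U" by (auto simp: U_def V_def)
  have UVP: "U - V \<subseteq> P"
  proof
    fix t assume "t \<in> U - V"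
    then obtain i c d where t: "t = (i, c, d)" "c < d" "(i, c) \<in> D" "(i + 1, d) \<in> D" "t \<notin> V"
      by (auto simp: U_def)
    then have "F (i + 1, d) \<le> F (i, c)" by (simp add: V_def)
    \<comment> \<open>Here \<open>F (i, d) < F (i + 1, d) \<le> F (i, c)\<close>, the first
      inequality by strictness in column \<open>d\<close>.\<close>
    moreover from t have "(i, d) \<in> D" using closed[of i c] closed(2)[of "i + 1" d] by simp
    ultimately show "t \<in> P" using strict[of i d] t by (simp add: P_def)
  qed
  have "Inv_set n lam F = (\<lambda>(i, c, d). ((i, c), (i, d))) ` P \<union> (\<lambda>(i, c, d). ((i + 1, d), (i, c))) ` V"
    (is "_ = ?P \<union> ?V")
  proof (intro equalityI subsetI)
    fix t assume "t \<in> Inv_set n lam F"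
    then obtain i c k d where t: "t = ((i, c), (k, d))" and *: "(i, c) \<in> D" "(k, d) \<in> D"
      "attack (i, c) (k, d)" "reads_before (i, c) (k, d)" "F (k, d) < F (i, c)"
      by (auto simp: Inv_set_def D_def)
    from *(3,4) consider "k = i" "c < d" | "i = k + 1" "d < c"
      by (auto simp: attack_def reads_before_def)
    then show "t \<in> ?P \<union> ?V"
    proof cases
      case 1
      then have "(i, c, d) \<in> P" using * by (simp add: P_def)
      then show ?thesis using 1 t by force
    next
      case 2
      then have "(k, d, c) \<in> V" using * by (simp add: V_def)
      then show ?thesis using 2 t by force
    qed
  qed (auto simp: P_def V_def Inv_set_def attack_def reads_before_def D_def)
  moreover have "card (?P \<union> ?V) = card ?P + card ?V"
    using finPU VU by (intro card_Un_disjoint) (auto intro: finite_subset)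
  moreover have "card ?P = card P" "card ?V = card V"
    by (auto intro!: card_image simp: inj_on_def)
  ultimately have inv: "card (Inv_set n lam F) = card P + card V" by simp
  have "(\<Sum>u\<in>Des_set n lam F. arm n lam u)
      = card (SIGMA u:Des_set n lam F. {w \<in> D. fst w = fst u \<and> snd w > snd u})"
    unfolding arm_def D_def[symmetric]
    by (rule card_SigmaI[symmetric]) (use fin in \<open>auto simp: Des_set_def D_def\<close>)
  also have "\<dots> = card U"
  \<comment> \<open>A triple of \<open>U\<close> is labelled by the row above the descent; the
    descent \<open>(i + 1, c)\<close> lies in the diagram because Young diagrams are
    left-justified.\<close>
  proof (rule bij_betw_same_card[where f = "\<lambda>(u, w). (fst u - 1, snd u, snd w)"],
      rule bij_betw_byWitness[where f' = "\<lambda>(i, c, d). ((i + 1, c), (i + 1, d))"])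
    have "((i + 1, c), (i + 1, d)) \<in> (SIGMA u:Des_set n lam F. {w \<in> D. fst w = fst u \<and> snd w > snd u})"
      if "c < d" "(i, c) \<in> D" "(i + 1, d) \<in> D" for i c d
      using that strict[of i c] left[of "i + 1" d c] pos[of i c] closed(1)[of i c]
      by (simp add: Des_set_def flip: D_def)
    then show "(\<lambda>(i, c, d). ((i + 1, c), i + 1, d)) ` U
        \<subseteq> (SIGMA u:Des_set n lam F. {w \<in> D. fst w = fst u \<and> snd u < snd w})"
      by (auto simp: U_def)
  qed (use closed in \<open>auto simp: U_def Des_set_def simp flip: D_def\<close>)
  finally have arms: "(\<Sum>u\<in>Des_set n lam F. arm n lam u) = card U" .
  \<comment> \<open>Exchanging the columns puts the larger entry first; the condition on the cell
    below then says exactly that the triple avoids \<open>U - V\<close>.\<close>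
  have "quinv_by (>) D F = card (P - (U - V))"
    unfolding quinv_by_def
    by (rule bij_betw_same_card[where f = "\<lambda>(i, c, d). (i, d, c)"],
      rule bij_betw_byWitness[where f' = "\<lambda>(i, c, d). (i, d, c)"])
      (auto simp: P_def U_def V_def)
  also have "\<dots> = card P - (card U - card V)"
    using finPU VU UVP by (simp add: card_Diff_subset finite_subset)
  finally have "int (quinv_by (>) D F) = int (card P) - (int (card U) - int (card V))"
    using card_mono[OF finPU(1) UVP] card_mono[OF finPU(2) VU] finPU VU
    by (simp add: card_Diff_subset finite_subset of_nat_diff)
  then show ?thesis by (simp add: hhl_inv_def inv arms D_def)
qed

section \<open>Sorting the rows of a filling\<close>

lemma sorted_nth_le_iff:
  "sorted xs \<Longrightarrow> k < length xs \<Longrightarrow> xs ! k \<le> v \<longleftrightarrow> k < length (filter (\<lambda>x. x \<le> v) xs)"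
proof (induction xs arbitrary: k)
  case (Cons x xs)
  show ?case
  proof (cases "x \<le> v")
    case True
    then show ?thesis using Cons by (cases k) auto
  next
    case False
    then have "\<not> y \<le> v" if "y \<in> set (x # xs)" for y using Cons.prems(1) that by auto
    then have "filter (\<lambda>x. x \<le> v) (x # xs) = []" "\<not> (x # xs) ! k \<le> v"
      using Cons.prems(2) nth_mem[of k "x # xs"] by (auto simp: filter_empty_conv)
    then show ?thesis by simp
  qed
qed simp

text \<open>In a sorted row the entries at most \<open>v\<close> form an initial segment, whose
  length sorting does not change. This turns questions about \<open>rsort\<close> into counts in
  \<open>F\<close>.\<close>

lemma rsort_le_iff:
  assumes "(i, c) \<in> dg n lam"
  shows "rsort n lam F (i, c) \<le> v \<longleftrightarrow> c \<le> card {d \<in> row (dg n lam) i. F (i, d) \<le> v}"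
proof -
  let ?xs = "map (\<lambda>d. F (i, d)) [1..<lam i + 1]"
  have c: "1 \<le> i" "i \<le> n" "1 \<le> c" "c \<le> lam i" using assms by (auto simp: dg_def)
  have "length (filter (\<lambda>x. x \<le> v) (sort ?xs)) = length (filter (\<lambda>x. x \<le> v) ?xs)"
    by (simp add: filter_sort)
  also have "\<dots> = length (filter (\<lambda>d. F (i, d) \<le> v) [1..<lam i + 1])"
    by (simp add: filter_map comp_def)
  also have "\<dots> = card {d \<in> row (dg n lam) i. F (i, d) \<le> v}"
  proof -
    have "{d \<in> row (dg n lam) i. F (i, d) \<le> v} = set (filter (\<lambda>d. F (i, d) \<le> v) [1..<lam i + 1])"
      using c by (auto simp: row_dg simp del: upt_Suc)
    then show ?thesis by (simp only: distinct_card distinct_filter distinct_upt)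
  qed
  \<comment> \<open>List positions start at 0, columns at 1.\<close>
  finally have "sort ?xs ! (c - 1) \<le> v \<longleftrightarrow> c - 1 < card {d \<in> row (dg n lam) i. F (i, d) \<le> v}"
    using c sorted_nth_le_iff[of "sort ?xs" "c - 1" v] by simp
  then show ?thesis using c assms by (simp add: rsort_def) linarith
qed

text \<open>Column strictness follows from counting: every entry at most \<open>v + 1\<close> in row
  \<open>i + 1\<close> has an entry at most \<open>v\<close> above it, so row \<open>i\<close> has
  at least as many entries at most \<open>v\<close>.\<close>

lemma rsort_SSYT:
  assumes "partition_at_most n lam" "F \<in> CSF n lam"
  shows "rsort n lam F \<in> SSYT n lam"
proof -
  define D where "D = dg n lam"
  define S where "S = rsort n lam F"
  have FD: "1 \<le> F x" "F x \<le> n" if "x \<in> D" for x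
    using assms(2) that by (auto simp: CSF_def D_def dest: PiE_mem)
  have le: "S (i, c) \<le> v \<longleftrightarrow> c \<le> card {d \<in> row D i. F (i, d) \<le> v}" if "(i, c) \<in> D" for i c v
    using that rsort_le_iff by (simp add: S_def D_def)
  have pos: "1 \<le> c" if "(i, c) \<in> D" for i c using that by (simp add: D_def dg_def)
  have range: "S (i, c) \<in> {1..n}" if "(i, c) \<in> D" for i c
  proof -
    have "{d \<in> row D i. F (i, d) \<le> n} = row D i" using FD by (auto simp: row_def)
    moreover have "c \<le> card (row D i)" using that unfolding D_def row_dg by (simp add: dg_def)
    ultimately have "S (i, c) \<le> n" using le[OF that] by simp
    \<comment> \<open>Positivity is the case \<open>v = 0\<close> of \<open>le\<close>: the count is
      0, while columns start at 1.\<close>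
    moreover have "{d \<in> row D i. F (i, d) \<le> 0} = {}" using FD by (fastforce simp: row_def)
    then have "\<not> S (i, c) \<le> 0" using that le[of i c 0] pos by (simp only: card.empty) force
    ultimately show ?thesis by simp
  qed
  have "S (i, c) < S (i + 1, c)" if c: "(i, c) \<in> D" "(i + 1, c) \<in> D" for i c
  proof (rule ccontr)
    define v where "v = S (i, c) - 1"
    assume "\<not> S (i, c) < S (i + 1, c)"
    moreover have v: "S (i, c) = v + 1" using range[OF c(1)] by (simp add: v_def)
    ultimately have "S (i + 1, c) \<le> v + 1" by simp
    then have "c \<le> card {d \<in> row D (i + 1). F (i + 1, d) \<le> v + 1}" using le c(2) by simp
    also have "\<dots> \<le> card {d \<in> row D i. F (i, d) \<le> v}"
    proof (rule card_mono)
      show "finite {d \<in> row D i. F (i, d) \<le> v}" by (simp add: D_def finite_dg)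
      have "(i, d) \<in> D \<and> F (i, d) < F (i + 1, d)" if d: "(i + 1, d) \<in> D" for d
      proof -
        have "(i, d) \<in> D"
          using column_closed_dg[OF assms(1)] d c(1) by (force simp: column_closed_def D_def dg_def)
        then show ?thesis using assms(2) d by (simp add: CSF_def D_def)
      qed
      then show "{d \<in> row D (i + 1). F (i + 1, d) \<le> v + 1} \<subseteq> {d \<in> row D i. F (i, d) \<le> v}"
        by (fastforce simp: row_def)
    qed
    finally show False using le[OF c(1), of v] v by simp
  qed
  moreover have "S (i, c) \<le> S (i, c + 1)" if "(i, c) \<in> D" "(i, c + 1) \<in> D" for i c
    using le[OF that(1)] le[OF that(2), of "S (i, c + 1)"] by simp
  moreover have "S \<in> D \<rightarrow>\<^sub>E {1..n}"
    using range by (auto simp: S_def rsort_def D_def)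
  ultimately show ?thesis by (simp add: SSYT_def CSF_def S_def D_def)
qed

section \<open>Padded patterns and the fibre of the sorting map\<close>

definition pad :: "(nat \<Rightarrow> nat \<Rightarrow> nat) \<Rightarrow> nat \<Rightarrow> nat \<Rightarrow> nat" where
  "pad T j i = (if 1 \<le> i \<and> i \<le> j then T j i else 0)"

lemma padded_pattern_pad:
  assumes "T \<in> GT n lam"
  shows "padded_pattern n (pad T)"
  unfolding padded_pattern_def
proof (intro conjI allI impI)
  fix j i :: nat assume "j < n" "1 \<le> i"
  then show "pad T (j + 1) (i + 1) \<le> pad T j i" "pad T j i \<le> pad T (j + 1) i"
    using assms by (auto simp: pad_def GT_def)
qed (auto simp: pad_def)

text \<open>By \<open>rsort_le_iff\<close> the cells of a row with sorted entry at most
  \<open>j\<close> form a left-justified segment, so equality with the shape \<open>T j\<close> is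
  equality of row lengths. In rows \<open>i > j\<close>, which this shape lacks, the padding demands
  that no entry is at most \<open>j\<close>.\<close>

lemma rsort_fiber_eq_fillings:
  assumes "partition_at_most n lam" "T \<in> GT n lam"
  shows "rsort_fiber n lam T = fillings n (pad T) (dg n lam)"
proof -
  define D where "D = dg n lam"
  have "(\<forall>j\<in>{1..n}. {x \<in> D. rsort n lam F x \<le> j} = dg j (T j)) \<longleftrightarrow>
      (\<forall>j\<in>{1..n}. \<forall>i. card {d \<in> row D i. F (i, d) \<le> j} = pad T j i)" for F
  proof (rule ball_cong)
    fix j assume j: "j \<in> {1..n}"
    let ?S = "{x \<in> D. rsort n lam F x \<le> j}"
    let ?k = "\<lambda>i. card {d \<in> row D i. F (i, d) \<le> j}"
    have k: "?k i \<le> card (row D i)" for i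
      by (intro card_mono) (auto simp: D_def finite_dg)
    have row_S: "row ?S i = {1..?k i}" for i
    proof -
      have "row ?S i = {c \<in> row D i. c \<le> ?k i}"
        by (auto simp: row_def D_def rsort_le_iff)
      also have "\<dots> = {1..?k i}" using k[of i] by (auto simp: D_def row_dg split: if_splits)
      finally show ?thesis .
    qed
    have row_T: "row (dg j (T j)) i = {1..pad T j i}" for i by (simp add: row_dg pad_def)
    have "?S = dg j (T j) \<longleftrightarrow> (\<forall>i. row ?S i = row (dg j (T j)) i)"
      by (auto simp: row_def set_eq_iff)
    also have "\<dots> \<longleftrightarrow> (\<forall>i. ?k i = pad T j i)"
      unfolding row_S row_T by (auto simp: Icc_eq_Icc)
    finally show "?S = dg j (T j) \<longleftrightarrow> (\<forall>i. ?k i = pad T j i)" .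
  qed simp
  then show ?thesis
    using rsort_SSYT[OF assms(1)]
    by (auto simp: rsort_fiber_def pattern_tableau_def fillings_def CSF_def D_def)
qed

lemma NE_pad: "1 \<le> i \<Longrightarrow> i \<le> j \<Longrightarrow> NE (pad T) i j = NE T i j"
  and SE_pad: "1 \<le> i \<Longrightarrow> i \<le> j \<Longrightarrow> SE (pad T) i j = SE T i j"
  and SE_pad_last: "SE (pad T) (j + 1) j = 0"
  by (auto simp: NE_def SE_def pad_def)

text \<open>The induction over fillings starts at the empty diagram and also produces a factor for
  row \<open>v + 1\<close>. There \<open>SE\<close> is 0, so the factor is 1; for
  \<open>v = 0\<close> it is the only one.\<close>

lemma wt_eq_pad:
  assumes "n \<ge> 1" "\<And>m. m \<ge> 1 \<Longrightarrow> q_int q m \<noteq> 0"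
  shows "wt q n T = (\<Prod>v<n. \<Prod>i\<in>{1..v + 1}.
    q_binomial q (NE (pad T) i v + SE (pad T) i v) (NE (pad T) i v))"
proof -
  have "{..<n} = insert 0 {1..<n}" using assms(1) by auto
  moreover have "(\<Prod>i\<in>{1..v + 1}. q_binomial q (NE (pad T) i v + SE (pad T) i v) (NE (pad T) i v))
      = (\<Prod>i\<in>{1..v}. q_binomial q (NE T i v + SE T i v) (NE T i v))" for v
    using SE_pad_last[of T v] assms(2)
    by (simp add: q_binomial_self NE_pad SE_pad cong: prod.cong_simp)
  ultimately show ?thesis by (simp add: wt_def)
qed

text \<open>The additional terms contain the factor \<open>SE = 0\<close>, as in
  \<open>wt_eq_pad\<close>.\<close>

lemma area_eq_pad:
  assumes "n \<ge> 1"
  shows "area n T = (\<Sum>v<n. \<Sum>i\<in>{1..v + 1}. NE (pad T) i v * SE (pad T) i v)"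
proof -
  have "{..<n} = insert 0 {1..<n}" using assms(1) by auto
  moreover have "(\<Sum>i\<in>{1..v + 1}. NE (pad T) i v * SE (pad T) i v)
      = (\<Sum>i\<in>{1..v}. NE T i v * SE T i v)" for v
    using SE_pad_last[of T v] by (simp add: NE_pad SE_pad cong: sum.cong_simp)
  ultimately show ?thesis by (simp add: area_def)
qed

theorem corollary1:
  fixes n :: nat and lam :: "nat \<Rightarrow> nat" and T :: "nat \<Rightarrow> nat \<Rightarrow> nat"
  assumes "n \<ge> 1"
    and "partition_at_most n lam"
    and "T \<in> GT n lam"
  shows "((\<Sum>F\<in>rsort_fiber n lam T. indet powi hhl_inv n lam F)
            = (\<Sum>F\<in>rsort_fiber n lam T. indet ^ quinv n lam F)
          \<and> (\<Sum>F\<in>rsort_fiber n lam T. indet ^ quinv n lam F) = wt indet n T)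
       \<and> (\<forall>F\<in>rsort_fiber n lam T. hhl_inv n lam F + int (quinv n lam F) = int (area n T))
       \<and> (\<forall>F\<in>rsort_fiber n lam T. \<forall>G\<in>rsort_fiber n lam T.
            hhl_inv n lam F + int (quinv n lam F) = hhl_inv n lam G + int (quinv n lam G))"
proof -
  note fiber = rsort_fiber_eq_fillings[OF assms(2,3)]
  have inv: "hhl_inv n lam F = int (quinv_by (>) (dg n lam) F)" if "F \<in> rsort_fiber n lam T" for F
    using hhl_inv_eq_quinv_by[OF assms(2)] that by (simp add: rsort_fiber_def)
  have rows: "card (row (dg n lam) i) = pad T n i" for i
    using assms(3) by (auto simp: row_dg pad_def GT_def)
  note dg = order_refl finite_dg column_closed_dg[OF assms(2)] rows
  have wt: "wt indet n T = (\<Prod>v<n. \<Prod>i\<in>{1..v + 1}.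
      q_binomial indet (NE (pad T) i v + SE (pad T) i v) (NE (pad T) i v))"
    using assms(1) q_int_indet_nonzero by (rule wt_eq_pad)
  have gf: "(\<Sum>F\<in>rsort_fiber n lam T. indet ^ quinv_by R (dg n lam) F) = wt indet n T"
    if "subset_gf R indet" for R
    unfolding fiber wt
    by (rule sum_quinv_by_fillings[OF that padded_pattern_pad[OF assms(3)] dg])
  have area: "hhl_inv n lam F + int (quinv n lam F) = int (area n T)"
    if "F \<in> rsort_fiber n lam T" for F
  proof -
    \<comment> \<open>The two orders of the columns together impose no condition, which leaves the
      count of \<open>quinv_by_True\<close>.\<close>
    have "quinv n lam F + quinv_by (>) (dg n lam) F = area n T"
      unfolding quinv_eq_quinv_by area_eq_pad[OF assms(1)] quinv_by_less_add_greater[OF finite_dg]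
      by (rule quinv_by_True[OF padded_pattern_pad[OF assms(3)] dg that[unfolded fiber]])
    then show ?thesis using inv[OF that] by simp
  qed
  \<comment> \<open>By \<open>inv\<close> the exponent is the image of a natural number, so
    \<open>powi\<close> becomes an ordinary power.\<close>
  have "(\<Sum>F\<in>rsort_fiber n lam T. indet powi hhl_inv n lam F) = wt indet n T"
    using gf[OF subset_gf_greater[OF q_int_indet_nonzero]] by (simp add: inv cong: sum.cong)
  moreover have "(\<Sum>F\<in>rsort_fiber n lam T. indet ^ quinv n lam F) = wt indet n T"
    using gf[OF subset_gf_less[OF q_int_indet_nonzero]] by (simp add: quinv_eq_quinv_by)
  ultimately show ?thesis using area by simp
qed

end
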